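(* Let $A\in\mathbb{R}^{n\times n}$ be symmetric, let $b\in\mathbb{R}^n$, and suppose that $f(x)=\frac{1}{2}x^\intercal A x - x^\intercal b$ is convex on $\mathbb{R}^n$, bounded below, and has at least one minimizer. Let $x^{(1)}\in\mathbb{R}^n$, and let $x^{(1)},x^{(2)},\dots$ be the iterates generated by the O-ACCEL algorithm applied to $f$ from $x^{(1)}$, with a steepest descent preconditioner $\mathcal{M}$ and taking the step $x^{(k+1)}=x^A$ at every iteration $k$. Then the O-ACCEL iterates form the FOM sequence of the linear system $Ax=b$ with initial guess $x^{(1)}$; that is, for every $k\ge 1$ for which $x^{(k+1)}$ is generated, $$x^{(k+1)}\in x^{(1)}+\mathcal{K}_k(A,r^{(1)})\quad\text{and}\quad b-Ax^{(k+1)}\perp \mathcal{K}_k(A,r^{(1)}).$$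
   Context: Residuals: $r^{(k)}=b-Ax^{(k)}$. The gradient of $f$ is $g(x)=\nabla f(x)=Ax-b$, so $r^{(k)}=-g(x^{(k)})$, and the Hessian of $f$ is $A$. Krylov subspaces: $\mathcal{K}_k(A,r^{(1)})=\mathrm{span}\{r^{(1)},Ar^{(1)},\dots,A^{k-1}r^{(1)}\}$. Orthogonality is with respect to the Euclidean inner product. FOM (full orthogonalization method): for the linear system $Ax=b$ with initial guess $x^{(1)}$ and $r^{(1)}=b-Ax^{(1)}$, the iterate $x^{(k+1)}$ of FOM is an element of $x^{(1)}+\mathcal{K}_k(A,r^{(1)})$ such that $b-Ax^{(k+1)}\perp\mathcal{K}_k(A,r^{(1)})$. O-ACCEL iteration considered here: given all previous iterates $x^{(1)},\dots,x^{(k)}$ with $r^{(k)}\neq 0$ (the algorithm stops if $r^{(k)}=0$): 1. Steepest descent preconditioner: $x^P=\mathcal{M}(f,x^{(k)})=x^{(k)}+\lambda^{(k)}r^{(k)}$ for some $\lambda^{(k)}>0$. 2. Let $X=[x^{(1)},\dots,x^{(k)}]\in\mathbb{R}^{n\times k}$, $X^P=[x^P,\dots,x^P]\in\mathbb{R}^{n\times k}$, $g(X)=[g(x^{(1)}),\dots,g(x^{(k)})]$, and $g(X^P)=[g(x^P),\dots,g(x^P)]$. Let $\alpha\in\mathbb{R}^k$ solve $$(X-X^P)^\intercal\bigl(g(X)-g(X^P)\bigr)\alpha=-(X-X^P)^\intercal g(x^P).$$ For the quadratic $f$ this is the same system as $(X-X^P)^\intercal A(X-X^P)\alpha=-(X-X^P)^\intercal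 g(x^P)$, in which the exact Hessian is used. 3. Set $x^A=x^P+\sum_{j=1}^k\alpha_j(x^{(j)}-x^P)$ and $x^{(k+1)}=x^A$ (no line search between $x^P$ and $x^A$, no restart, and the full history of iterates is kept). *)

theory Defs
  imports "HOL-Analysis.Analysis"
begin

definition gradient :: "('a::real_inner \<Rightarrow> real) \<Rightarrow> 'a \<Rightarrow> 'a" where
  "gradient f x = (THE D. GDERIV f x :> D)"

lemma gradient_eq:
  assumes "GDERIV f x :> D"
  shows "gradient f x = D"
proof -
  have "D' = D" if "GDERIV f x :> D'" for D'
  proof -
    have "(\<lambda>h. h \<bullet> D') = (\<lambda>h. h \<bullet> D)"
      using that assms unfolding gderiv_def by (rule has_derivative_unique)
    then have "(D' - D) \<bullet> D' = (D' - D) \<bullet> D"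
      by metis
    then have "(D' - D) \<bullet> (D' - D) = 0"
      by (simp add: inner_diff_right)
    then show ?thesis
      by simp
  qed
  with assms show ?thesis
    unfolding gradient_def by (blast intro: the_equality)
qed

definition quadratic :: "real^'n^'n \<Rightarrow> real^'n \<Rightarrow> real^'n \<Rightarrow> real" where
  "quadratic A b x = 1/2 * (x \<bullet> (A *v x)) - x \<bullet> b"

definition residual :: "real^'n^'n \<Rightarrow> real^'n \<Rightarrow> real^'n \<Rightarrow> real^'n" where
  "residual A b x = b - A *v x"

lemma gradient_quadratic:
  fixes A :: "real^'n^'n"
  assumes "transpose A = A"
  shows "gradient (quadratic A b) x = - residual A b x"
proof (rule gradient_eq)
  have A: "x \<bullet> (A *v h) = h \<bullet> (A *v x)" for h
    by (metis assms dot_lmul_matrix inner_commute matrix_vector_mul_assoc transpose_matrix_vector)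
  have "(quadratic A b has_derivative
      (\<lambda>h. 1/2 * (x \<bullet> (A *v h) + h \<bullet> (A *v x)) - h \<bullet> b)) (at x)"
    unfolding quadratic_def
    by (auto intro!: derivative_eq_intros bounded_linear.has_derivative[OF matrix_vector_mul_bounded_linear])
  then show "GDERIV (quadratic A b) x :> - residual A b x"
    by (simp add: gderiv_def A residual_def inner_diff_right)
qed

text \<open>
  In the remaining definitions iterates are indexed from 1; the value of a sequence
  at 0 is irrelevant.

  \<open>generated f x k\<close>: the iteration has not stopped at an iterate preceding \<open>x k\<close>.
\<close>

definition generated :: "('a::real_inner \<Rightarrow> real) \<Rightarrow> (nat \<Rightarrow> 'a) \<Rightarrow> nat \<Rightarrow> bool" where
  "generated f x k \<longleftrightarrow> (\<forall>j\<in>{1..<k}. gradient f (x j) \<noteq> 0)"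

text \<open>
  The \<open>k \<times> k\<close> system
  \<open>(X - X\<^sup>P)\<^sup>T (g(X) - g(X\<^sup>P)) \<alpha> = - (X - X\<^sup>P)\<^sup>T g(x\<^sup>P)\<close> with \<open>g = gradient f\<close>, row by row,
  where \<open>X = [x 1, \<dots>, x k]\<close> and \<open>X\<^sup>P = [x\<^sup>P, \<dots>, x\<^sup>P]\<close>. Only \<open>\<alpha> 1, \<dots>, \<alpha> k\<close> matter. The system may
  a priori be singular; any solution is admitted.
\<close>

definition oaccel_system ::
  "('a::real_inner \<Rightarrow> real) \<Rightarrow> (nat \<Rightarrow> 'a) \<Rightarrow> nat \<Rightarrow> 'a \<Rightarrow> (nat \<Rightarrow> real) \<Rightarrow> bool" where
  "oaccel_system f x k xP \<alpha> \<longleftrightarrow>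
     (\<forall>i\<in>{1..k}. (\<Sum>j=1..k. ((x i - xP) \<bullet> (gradient f (x j) - gradient f xP)) * \<alpha> j)
                  = - ((x i - xP) \<bullet> gradient f xP))"

text \<open>
  \<open>x\<close> is the sequence of iterates from \<open>x1\<close>, \<open>xP k\<close> being the preconditioned iterate obtained
  from \<open>x k\<close>. Values of \<open>x\<close> after the iteration has stopped are unconstrained.
\<close>

definition oaccel ::
  "('a::real_inner \<Rightarrow> real) \<Rightarrow> (nat \<Rightarrow> 'a) \<Rightarrow> 'a \<Rightarrow> (nat \<Rightarrow> 'a) \<Rightarrow> bool" where
  "oaccel f xP x1 x \<longleftrightarrow> x 1 = x1 \<and>
     (\<forall>k\<ge>1. generated f x (k + 1) \<longrightarrow>
       (\<exists>\<alpha>. oaccel_system f x k (xP k) \<alpha> \<and>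
            x (k + 1) = xP k + (\<Sum>j=1..k. \<alpha> j *\<^sub>R (x j - xP k))))"

definition krylov :: "real^'n^'n \<Rightarrow> real^'n \<Rightarrow> nat \<Rightarrow> (real^'n) set" where
  "krylov A r k = span ((\<lambda>i. ((*v) A ^^ i) r) ` {..<k})"

definition fom_iterate :: "real^'n^'n \<Rightarrow> real^'n \<Rightarrow> real^'n \<Rightarrow> nat \<Rightarrow> real^'n \<Rightarrow> bool" where
  "fom_iterate A b x1 k y \<longleftrightarrow>
     y \<in> (\<lambda>v. x1 + v) ` krylov A (residual A b x1) k \<and>
     (\<forall>v\<in>krylov A (residual A b x1) k. orthogonal (b - A *v y) v)"

end

theory Submission
  imports Defs
begin

text \<open>
  The linear system for \<open>\<alpha>\<close> is a Galerkin condition: it says that the residual at the accelerated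
  point is orthogonal to \<open>D = span {x j - x\<^sup>P | j \<le> k}\<close> (\<open>oaccel_step_residual_orthogonal\<close>). The
  FOM iterate is characterised by orthogonality to the Krylov space \<open>K\<^sub>k\<close>, so everything rests on
  showing that \<open>D\<close> contains all of \<open>K\<^sub>k\<close>, that is, that the history of iterates never degenerates.

  By induction, the differences \<open>x j - x 1\<close> with \<open>j \<le> k\<close> span \<open>K\<^bsub>k-1\<^esub>\<close>, and the residual \<open>r\<close> at
  \<open>x k\<close> is orthogonal to \<open>K\<^bsub>k-1\<^esub>\<close>. Since \<open>r\<close> lies in \<open>K\<^sub>k\<close> and is not zero, it
  is a direction of \<open>K\<^sub>k\<close> outside \<open>K\<^bsub>k-1\<^esub>\<close>. One such direction suffices to complete
  \<open>K\<^bsub>k-1\<^esub>\<close> to \<open>K\<^sub>k\<close> (\<open>krylov_exchange\<close>), and the steepest descent step \<open>x\<^sup>P - x k\<close>, a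
  nonzero multiple of \<open>r\<close>, puts it into \<open>D\<close>. Thus \<open>D\<close> contains \<open>K\<^sub>k\<close>, and the new iterate
  satisfies the FOM conditions.

  To continue the induction, \<open>x (k + 1) - x 1\<close> must in turn leave \<open>K\<^bsub>k-1\<^esub>\<close>. Otherwise the step
  \<open>d = x (k + 1) - x k\<close> would lie in \<open>K\<^bsub>k-1\<^esub>\<close>, to which both residuals are orthogonal, whence
  \<open>d \<bullet> A d = 0\<close>. Convexity makes \<open>A\<close> positive semidefinite, so \<open>A d = 0\<close> and the two residuals
  coincide; but the new one is orthogonal to \<open>K\<^sub>k\<close>, which contains the old one, so that
  the residual would vanish (\<open>galerkin_step_leaves_krylov\<close>).
\<close>

section \<open>Positive semidefinite matrices\<close>

lemma symmetric_matrix_inner: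
  fixes A :: "real^'n^'n"
  assumes "transpose A = A"
  shows "x \<bullet> (A *v y) = (A *v x) \<bullet> y"
  by (metis assms dot_lmul_matrix transpose_matrix_vector)

text \<open>The linear term of the quadratic is odd, so convexity between \<open>v\<close> and \<open>- v\<close> isolates the
  quadratic form.\<close>

lemma convex_quadratic_imp_psd:
  fixes A :: "real^'n^'n"
  assumes "convex_on UNIV (quadratic A b)"
  shows "0 \<le> v \<bullet> (A *v v)"
proof -
  have "quadratic A b ((1 - 1/2) *\<^sub>R v + (1/2) *\<^sub>R (- v))
      \<le> (1 - 1/2) * quadratic A b v + (1/2) * quadratic A b (- v)"
    by (rule convex_onD[OF assms]) auto
  moreover have "A *v (- v) = - (A *v v)"
    using matrix_vector_mult_scaleR[of A "-1" v] by simp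
  ultimately show ?thesis
    by (simp add: quadratic_def field_simps)
qed

lemma psd_form_zero_imp_kernel:
  fixes A :: "real^'n^'n"
  assumes sym: "transpose A = A" and psd: "\<And>v. 0 \<le> v \<bullet> (A *v v)" and zero: "d \<bullet> (A *v d) = 0"
  shows "A *v d = 0"
proof (rule ccontr)
  define w where "w = A *v d"
  define c where "c = w \<bullet> w"
  define q where "q = w \<bullet> (A *v w)"
  \<comment> \<open>Along the line \<open>d + s w\<close> the form is \<open>2 s c + s\<^sup>2 q\<close>, negative for small negative \<open>s\<close>;
    dividing by \<open>q + 1\<close> rather than \<open>q\<close> covers \<open>q = 0\<close>.\<close>
  define s where "s = - c / (q + 1)"
  assume "A *v d \<noteq> 0"
  then have c: "c > 0"
    by (simp add: c_def w_def)
  have q: "q \<ge> 0"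
    by (simp add: q_def psd)
  have "d \<bullet> (A *v w) = c"
    by (simp add: symmetric_matrix_inner[OF sym] c_def w_def)
  then have "(d + s *\<^sub>R w) \<bullet> (A *v (d + s *\<^sub>R w)) = 2 * s * c + s * (s * q)"
    using zero
    by (simp add: matrix_vector_right_distrib matrix_vector_mult_scaleR inner_add_left
        inner_add_right flip: w_def) (simp add: c_def q_def algebra_simps)
  also have "\<dots> = s * (2 * c + s * q)"
    by (simp add: algebra_simps)
  also have "\<dots> < 0"
  proof (rule mult_neg_pos)
    show "s < 0"
      using c q by (simp add: s_def)
    have "c * q / (q + 1) \<le> c"
      using c q by (simp add: field_simps)
    then show "0 < 2 * c + s * q"
      using c by (simp add: s_def)
  qed
  finally show False
    using psd[of "d + s *\<^sub>R w"] by simp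
qed

section \<open>Krylov spaces\<close>

lemma subspace_krylov: "subspace (krylov A r k)"
  by (simp add: krylov_def)

lemma krylov_Suc:
  "krylov A r (Suc k) = span (insert (((*v) A ^^ k) r) ((\<lambda>i. ((*v) A ^^ i) r) ` {..<k}))"
  by (simp add: krylov_def lessThan_Suc)

lemma krylov_mono: "krylov A r k \<subseteq> krylov A r (Suc k)"
  unfolding krylov_Suc unfolding krylov_def by (rule span_mono) auto

lemma krylov_start: "r \<in> krylov A r (Suc k)"
proof -
  have "((*v) A ^^ 0) r \<in> krylov A r (Suc k)"
    unfolding krylov_def by (intro span_base imageI) simp
  then show ?thesis by simp
qed

lemma krylov_mult:
  fixes A :: "real^'n^'n"
  assumes "v \<in> krylov A r k"
  shows "A *v v \<in> krylov A r (Suc k)"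
proof -
  have "A *v v \<in> (*v) A ` span ((\<lambda>i. ((*v) A ^^ i) r) ` {..<k})"
    using assms by (simp add: krylov_def)
  also have "\<dots> = span ((*v) A ` (\<lambda>i. ((*v) A ^^ i) r) ` {..<k})"
    by (rule linear_span_image[symmetric]) simp
  also have "\<dots> \<subseteq> krylov A r (Suc k)"
    unfolding krylov_def
  proof (intro span_mono subsetI)
    fix u assume "u \<in> (*v) A ` (\<lambda>i. ((*v) A ^^ i) r) ` {..<k}"
    then obtain i where "i < k" "u = ((*v) A ^^ Suc i) r"
      by auto
    then show "u \<in> (\<lambda>i. ((*v) A ^^ i) r) ` {..<Suc k}"
      by blast
  qed
  finally show ?thesis .
qed

lemma residual_in_krylov:
  fixes A :: "real^'n^'n"
  assumes "y - x1 \<in> krylov A (residual A b x1) k"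
  shows "residual A b y \<in> krylov A (residual A b x1) (Suc k)"
proof -
  have "residual A b y = residual A b x1 - A *v (y - x1)"
    by (simp add: residual_def matrix_vector_mult_diff_distrib)
  then show ?thesis
    using krylov_start krylov_mult[OF assms] by (metis subspace_diff subspace_krylov)
qed

text \<open>Consecutive Krylov spaces differ by at most one dimension, so by the exchange lemma any
  vector that lies in the larger but not in the smaller one can replace the last generator.\<close>

lemma krylov_exchange:
  assumes "v \<in> krylov A r (Suc k)" and "v \<notin> krylov A r k"
    and "subspace S" and "krylov A r k \<subseteq> S" and "v \<in> S"
  shows "krylov A r (Suc k) \<subseteq> S"
proof -
  let ?G = "(\<lambda>i. ((*v) A ^^ i) r) ` {..<k}"
  have G: "?G \<subseteq> S"
    using assms(4) span_superset[of ?G] by (auto simp: krylov_def)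
  have "((*v) A ^^ k) r \<in> span (insert v ?G)"
    using assms(1,2) unfolding krylov_Suc unfolding krylov_def by (rule in_span_insert)
  also have "\<dots> \<subseteq> S"
    using G assms(3,5) by (intro span_minimal) auto
  finally show ?thesis
    unfolding krylov_Suc using G assms(3) by (intro span_minimal) auto
qed

section \<open>One step of the iteration\<close>

lemma gradient_quadratic_affine:
  fixes A :: "real^'n^'n"
  assumes "transpose A = A"
  shows "gradient (quadratic A b) y = A *v y - b"
  by (simp add: gradient_quadratic[OF assms] residual_def)

text \<open>The gradient of the quadratic is affine, so the left-hand side of the system sums up to
  \<open>A\<close> applied to the whole acceleration step.\<close>

lemma oaccel_step_residual_orthogonal:
  fixes A :: "real^'n^'n"
  assumes sym: "transpose A = A" and sys: "oaccel_system (quadratic A b) x k p \<alpha>"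
    and i: "i \<in> {1..k}"
  shows "(x i - p) \<bullet> residual A b (p + (\<Sum>j=1..k. \<alpha> j *\<^sub>R (x j - p))) = 0"
proof -
  have "(\<Sum>j=1..k. ((x i - p) \<bullet> (A *v (x j - p))) * \<alpha> j) = - ((x i - p) \<bullet> (A *v p - b))"
    using sys i
    by (simp add: oaccel_system_def gradient_quadratic_affine[OF sym] matrix_vector_mult_diff_distrib)
  moreover have "A *v (\<Sum>j=1..k. \<alpha> j *\<^sub>R (x j - p)) = (\<Sum>j=1..k. \<alpha> j *\<^sub>R (A *v (x j - p)))"
    by (simp add: linear_sum[OF matrix_vector_mul_linear] matrix_vector_mult_scaleR)
  ultimately show ?thesis
    by (simp add: residual_def matrix_vector_right_distrib inner_diff_right inner_add_right
        inner_sum_right mult.commute)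
qed

text \<open>A step within \<open>K\<^sub>k\<close> between two points whose residuals are both orthogonal to \<open>K\<^sub>k\<close> has zero
  energy, hence does not change the residual. If the residual lies in \<open>K\<^bsub>k+1\<^esub>\<close> and the step makes
  it orthogonal to that space, then it was zero already.\<close>

lemma galerkin_step_leaves_krylov:
  fixes A :: "real^'n^'n"
  assumes sym: "transpose A = A" and psd: "\<And>v. 0 \<le> v \<bullet> (A *v v)"
    and y: "\<And>v. v \<in> krylov A r k \<Longrightarrow> v \<bullet> residual A b y = 0"
    and z: "\<And>v. v \<in> krylov A r (Suc k) \<Longrightarrow> v \<bullet> residual A b z = 0"
    and ry: "residual A b y \<in> krylov A r (Suc k)" "residual A b y \<noteq> 0"
  shows "z - y \<notin> krylov A r k"
proof
  assume d: "z - y \<in> krylov A r k"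
  have A_d: "A *v (z - y) = residual A b y - residual A b z"
    by (simp add: residual_def matrix_vector_mult_diff_distrib)
  have "(z - y) \<bullet> residual A b z = 0"
    using d krylov_mono z by blast
  then have "(z - y) \<bullet> (A *v (z - y)) = 0"
    by (simp add: A_d inner_diff_right y[OF d])
  then have "A *v (z - y) = 0"
    by (rule psd_form_zero_imp_kernel[OF sym psd])
  then have "residual A b y \<bullet> residual A b y = 0"
    using z[OF ry(1)] A_d by simp
  then show False
    using ry(2) by simp
qed

section \<open>O-ACCEL iterates are FOM iterates\<close>

text \<open>The span condition is stronger than membership of the last iterate in \<open>x1 + K\<^sub>k\<close>: it says
  that the history of iterates is rich enough for the next system to impose all the
  orthogonality relations of FOM.\<close>

lemma oaccel_invariant:
  fixes A :: "real^'n^'n" and x xP :: "nat \<Rightarrow> real^'n"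
  assumes sym: "transpose A = A" and psd: "\<And>v. 0 \<le> v \<bullet> (A *v v)"
    and oaccel: "oaccel (quadratic A b) xP x1 x"
    and descent: "\<And>k. k \<ge> 1 \<Longrightarrow> generated (quadratic A b) x (k + 1) \<Longrightarrow>
           \<exists>t>0. xP k = x k + t *\<^sub>R residual A b (x k)"
    and gen: "generated (quadratic A b) x (k + 1)"
  shows "span ((\<lambda>j. x j - x1) ` {1..k + 1}) = krylov A (residual A b x1) k \<and>
    (\<forall>v\<in>krylov A (residual A b x1) k. v \<bullet> residual A b (x (k + 1)) = 0)"
  using gen
proof (induction k)
  case 0
  have "x 1 = x1"
    using oaccel by (simp add: oaccel_def)
  then show ?case
    by (simp add: krylov_def)
next
  case (Suc k)
  define K where "K = krylov A (residual A b x1)"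
  define m where "m = k + 1"
  have K_sub: "subspace (K i)" and K_mono: "K i \<subseteq> K (Suc i)" for i
    by (simp_all add: K_def subspace_krylov krylov_mono)
  have m: "m \<ge> 1" "m = Suc k" and gen_m: "generated (quadratic A b) x (m + 1)"
    using Suc.prems by (simp_all add: m_def)
  have x1: "x 1 = x1"
    using oaccel by (simp add: oaccel_def)
  have "generated (quadratic A b) x (k + 1)"
    using Suc.prems by (simp add: generated_def)
  note IH = Suc.IH[OF this]
  have span_K: "span ((\<lambda>j. x j - x1) ` {1..m}) = K k"
    using IH by (simp add: K_def m_def)
  have orth_k: "v \<bullet> residual A b (x m) = 0" if "v \<in> K k" for v
    using IH that by (simp add: K_def m_def)
  have history: "x j - x1 \<in> K k" if "j \<in> {1..m}" for j
    unfolding span_K[symmetric] using that by (intro span_base imageI)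
  have res_in: "residual A b (x m) \<in> K m"
    using residual_in_krylov history[of m] m by (simp add: K_def)
  have res_nz: "residual A b (x m) \<noteq> 0"
    using gen_m m by (auto simp: generated_def gradient_quadratic[OF sym])
  have res_new: "residual A b (x m) \<notin> K k"
    using orth_k[of "residual A b (x m)"] res_nz by auto
  obtain t where t: "t > 0" "xP m = x m + t *\<^sub>R residual A b (x m)"
    using descent[OF m(1) gen_m] by blast
  obtain \<alpha> where sys: "oaccel_system (quadratic A b) x m (xP m) \<alpha>"
    and step: "x (m + 1) = xP m + (\<Sum>j=1..m. \<alpha> j *\<^sub>R (x j - xP m))"
    using oaccel gen_m m unfolding oaccel_def by blast

  define D where "D = {v. v \<bullet> residual A b (x (m + 1)) = 0}"
  have D_sub: "subspace D"
    by (simp add: D_def subspace_def inner_add_left)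
  have D_gen: "x j - xP m \<in> D" if "j \<in> {1..m}" for j
    using oaccel_step_residual_orthogonal[OF sym sys that] unfolding D_def step by simp
  have "K m \<subseteq> D"
    unfolding K_def m(2)
  proof (rule krylov_exchange)
    show "krylov A (residual A b x1) k \<subseteq> D"
      unfolding K_def[symmetric] span_K[symmetric]
    proof (rule span_minimal[OF _ D_sub], clarify)
      fix j assume j: "j \<in> {1..m}"
      have "(x j - xP m) - (x 1 - xP m) \<in> D"
        using j m by (intro subspace_diff[OF D_sub] D_gen) auto
      then show "x j - x1 \<in> D"
        by (simp flip: x1)
    qed
    have "(- inverse t) *\<^sub>R (x m - xP m) \<in> D"
      using m by (intro subspace_scale[OF D_sub] D_gen) auto
    then show "residual A b (x m) \<in> D"
      using t by simp
  qed (use D_sub res_in res_new in \<open>simp_all add: K_def m(2)\<close>)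
  then have orth_m: "v \<bullet> residual A b (x (m + 1)) = 0" if "v \<in> K m" for v
    using that by (auto simp: D_def)

  have history_m: "x j - x1 \<in> K m" if "j \<in> {1..m}" for j
    using history[OF that] K_mono m by auto
  have xP_in: "xP m - x1 \<in> K m"
  proof -
    have "(x m - x1) + t *\<^sub>R residual A b (x m) \<in> K m"
      using m by (intro subspace_add[OF K_sub] subspace_scale[OF K_sub] res_in history_m) auto
    then show ?thesis
      by (simp add: t algebra_simps)
  qed
  have new_in: "x (m + 1) - x1 \<in> K m"
  proof -
    have "x j - xP m \<in> K m" if "j \<in> {1..m}" for j
      using subspace_diff[OF K_sub history_m[OF that] xP_in] by simp
    then have "(xP m - x1) + (\<Sum>j=1..m. \<alpha> j *\<^sub>R (x j - xP m)) \<in> K m"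
      by (intro subspace_add[OF K_sub] subspace_sum[OF K_sub] subspace_scale[OF K_sub] xP_in)
    then show ?thesis
      unfolding step by (simp add: algebra_simps)
  qed
  have new_out: "x (m + 1) - x1 \<notin> K k"
  proof
    assume "x (m + 1) - x1 \<in> K k"
    then have "(x (m + 1) - x1) - (x m - x1) \<in> K k"
      by (rule subspace_diff[OF K_sub _ history]) (use m in auto)
    moreover have "x (m + 1) - x m \<notin> K k"
      unfolding K_def using orth_k orth_m res_in res_nz m(2)
      by (intro galerkin_step_leaves_krylov[OF sym psd]) (auto simp: K_def)
    ultimately show False
      by simp
  qed

  let ?S = "span ((\<lambda>j. x j - x1) ` {1..m + 1})"
  have "K m \<subseteq> ?S"
    unfolding K_def m(2)
  proof (rule krylov_exchange)
    show "krylov A (residual A b x1) k \<subseteq> span ((\<lambda>j. x j - x1) ` {1..Suc k + 1})"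
      unfolding K_def[symmetric] span_K[symmetric] by (intro span_mono image_mono) (auto simp: m)
    show "x (m + 1) - x1 \<in> span ((\<lambda>j. x j - x1) ` {1..Suc k + 1})"
      by (intro span_base imageI) (simp add: m)
  qed (use new_in new_out in \<open>simp_all add: K_def m(2)\<close>)
  moreover have "?S \<subseteq> K m"
  proof (rule span_minimal[OF _ K_sub], clarify)
    fix j assume "j \<in> {1..m + 1}"
    then show "x j - x1 \<in> K m"
      using history_m new_in by (cases "j = m + 1") auto
  qed
  ultimately have "?S = K m"
    by simp
  then show ?case
    using orth_m by (simp add: K_def m(2))
qed

theorem theorem1:
  fixes A :: "real^'n^'n" and b x1 :: "real^'n" and x xP :: "nat \<Rightarrow> real^'n"
  assumes "transpose A = A"
    and "convex_on UNIV (quadratic A b)"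
    and "bdd_below (range (quadratic A b))"
    and "\<exists>m. \<forall>y. quadratic A b m \<le> quadratic A b y"
    and "oaccel (quadratic A b) xP x1 x"
    and "\<And>k. k \<ge> 1 \<Longrightarrow> generated (quadratic A b) x (k + 1) \<Longrightarrow>
           \<exists>t>0. xP k = x k + t *\<^sub>R residual A b (x k)"
  shows "\<forall>k\<ge>1. generated (quadratic A b) x (k + 1) \<longrightarrow> fom_iterate A b x1 k (x (k + 1))"
proof (intro allI impI)
  fix k :: nat
  assume gen: "generated (quadratic A b) x (k + 1)"
  note inv = oaccel_invariant[OF assms(1) convex_quadratic_imp_psd[OF assms(2)] assms(5,6) gen]
  have "x (k + 1) - x1 \<in> span ((\<lambda>j. x j - x1) ` {1..k + 1})"
    by (intro span_base imageI) simp
  then have "x (k + 1) - x1 \<in> krylov A (residual A b x1) k"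
    using inv by simp
  then have "x (k + 1) \<in> (\<lambda>v. x1 + v) ` krylov A (residual A b x1) k"
    by (intro image_eqI[where x = "x (k + 1) - x1"]) simp_all
  moreover have "\<forall>v\<in>krylov A (residual A b x1) k. orthogonal (b - A *v x (k + 1)) v"
    using inv by (simp add: orthogonal_def residual_def inner_commute)
  ultimately show "fom_iterate A b x1 k (x (k + 1))"
    by (simp add: fom_iterate_def)
qed

end
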